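(* Let $\mathbf a$ be an ordinary multisegment. Then: (1) there exist a symmetric multisegment $\mathbf a^{\mathrm{sym}}$ and integers $k_1,\dots,k_r$ such that $S(\mathbf a)\simeq S(\mathbf a^{\mathrm{sym}})_{k_r,\dots,k_1}$ as partially ordered sets; (2) there exists an element $\mathbf a'\in S(\mathbf a^{\mathrm{sym}})$ such that $$S(\mathbf a^{\mathrm{sym}})_{k_r,\dots,k_1}=\{\mathbf c\in S(\mathbf a^{\mathrm{sym}}):\mathbf c\ge\mathbf a'\}.$$
   Context: A segment is $\Delta=[i,j]=\{i,\dots,j\}$ with integers $i\le j$; $b(\Delta)=i$, $e(\Delta)=j$. A multisegment is a finite multiset of segments; empty segments are discarded; $\deg(\mathbf a)$ is the sum of the cardinalities of its segments. Two segments are linked if neither contains the other and their union is a segment. An elementary operation replaces a linked pair $\{\Delta,\Delta'\}$ by $\{\Delta\cup\Delta',\Delta\cap\Delta'\}$. Write $\mathbf b\le\mathbf a$ if $\mathbf b$ is obtained from $\mathbf a$ by a (possibly empty) series of elementary operations; $S(\mathbf a)=\{\mathbf b:\mathbf b\le\mathbf a\}$ with this order. A multisegment is ordinary if no two of its segments have the same beginning or the same end; it is symmetric if it is ordinary and $\max b(\Delta)\le\min e(\Delta)$ over its segments. Truncation: $\Delta^{(k)}=[i,j-1]$ if $\Delta=[i,j]$ with $j=k$, and $\Delta^{(k)}=\Delta$ otherwise; $\mathbf a^{(k)}=\{\Delta^{(k)}:\Delta\in\mathbf a\}$; $\mathbf a^{(l_1,\dots,l_r)}=(\cdots(\mathbf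 a^{(l_1)})\cdots)^{(l_r)}$. $S(\mathbf a)_k$ is the set of $\mathbf c\in S(\mathbf a)$ such that $\deg(\mathbf c^{(k)})=\deg(\mathbf a^{(k)})$ and $\mathbf c$ contains no pair of linked segments $\{\Delta,\Delta'\}$ with $e(\Delta)=k-1$, $e(\Delta')=k$. For a sequence of integers $(l_1,\dots,l_r)$, $$S(\mathbf a)_{l_1,\dots,l_r}=\{\mathbf c\in S(\mathbf a):\mathbf c^{(l_1,\dots,l_i)}\in S(\mathbf a^{(l_1,\dots,l_i)})_{l_{i+1}}\text{ for }0\le i\le r-1\}.$$ *)

theory Defs
  imports "HOL-Library.Multiset"
begin

(* A segment is a nonempty finite interval of integers, kept as a set of integers, so that
   inclusion, union and intersection of segments are the set-theoretic ones. *)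

type_synonym segment = "int set"
type_synonym multisegment = "segment multiset"

definition is_segment :: "segment \<Rightarrow> bool" where
  "is_segment D \<longleftrightarrow> (\<exists>i j. i \<le> j \<and> D = {i..j})"

definition seg_begin :: "segment \<Rightarrow> int" where
  "seg_begin D = Min D"

definition seg_end :: "segment \<Rightarrow> int" where
  "seg_end D = Max D"

definition is_multisegment :: "multisegment \<Rightarrow> bool" where
  "is_multisegment a \<longleftrightarrow> (\<forall>D \<in># a. is_segment D)"

definition discard_empty :: "multisegment \<Rightarrow> multisegment" where
  "discard_empty a = filter_mset (\<lambda>D. D \<noteq> {}) a"

definition mdeg :: "multisegment \<Rightarrow> nat" where
  "mdeg a = (\<Sum>D \<in># a. card D)"

definition linked :: "segment \<Rightarrow> segment \<Rightarrow> bool" where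
  "linked D E \<longleftrightarrow> \<not> D \<subseteq> E \<and> \<not> E \<subseteq> D \<and> is_segment (D \<union> E)"

definition elementary_op :: "multisegment \<Rightarrow> multisegment \<Rightarrow> bool" where
  "elementary_op a b \<longleftrightarrow>
     (\<exists>D E. {#D, E#} \<subseteq># a \<and> linked D E \<and>
            b = a - {#D, E#} + discard_empty {#D \<union> E, D \<inter> E#})"

definition mseg_le :: "multisegment \<Rightarrow> multisegment \<Rightarrow> bool" (infix "\<preceq>" 50) where
  "b \<preceq> a \<longleftrightarrow> elementary_op\<^sup>*\<^sup>* a b"

definition S :: "multisegment \<Rightarrow> multisegment set" where
  "S a = {b. b \<preceq> a}"

(* Quantifying over submultisets {#D, E#} also compares two copies of the same segment,
   so an ordinary multisegment has no repeated segments. *)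
definition ordinary :: "multisegment \<Rightarrow> bool" where
  "ordinary a \<longleftrightarrow> is_multisegment a \<and>
     (\<forall>D E. {#D, E#} \<subseteq># a \<longrightarrow> seg_begin D \<noteq> seg_begin E \<and> seg_end D \<noteq> seg_end E)"

(* max of the beginnings \<le> min of the ends; the empty multisegment satisfies this vacuously. *)
definition symmetric :: "multisegment \<Rightarrow> bool" where
  "symmetric a \<longleftrightarrow> ordinary a \<and> (\<forall>D \<in># a. \<forall>E \<in># a. seg_begin D \<le> seg_end E)"

definition trunc_seg :: "int \<Rightarrow> segment \<Rightarrow> segment" where
  "trunc_seg k D = (if seg_end D = k then {seg_begin D..seg_end D - 1} else D)"

definition trunc :: "int \<Rightarrow> multisegment \<Rightarrow> multisegment" where
  "trunc k a = discard_empty (image_mset (trunc_seg k) a)"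

(* truncs [l1, ..., lr] a truncates at l1 first and at lr last. *)
definition truncs :: "int list \<Rightarrow> multisegment \<Rightarrow> multisegment" where
  "truncs ls a = fold trunc ls a"

definition S_trunc1 :: "multisegment \<Rightarrow> int \<Rightarrow> multisegment set" where
  "S_trunc1 a k = {c \<in> S a. mdeg (trunc k c) = mdeg (trunc k a) \<and>
     \<not> (\<exists>D E. {#D, E#} \<subseteq># c \<and> linked D E \<and> seg_end D = k - 1 \<and> seg_end E = k)}"

definition S_trunc :: "multisegment \<Rightarrow> int list \<Rightarrow> multisegment set" where
  "S_trunc a ls = {c \<in> S a. \<forall>i < length ls.
     truncs (take i ls) c \<in> S_trunc1 (truncs (take i ls) a) (ls ! i)}"

(* Isomorphism of two sets of multisegments, both with the order induced by \<preceq>. *)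
definition order_iso :: "multisegment set \<Rightarrow> multisegment set \<Rightarrow> bool" where
  "order_iso A B \<longleftrightarrow>
     (\<exists>f. bij_betw f A B \<and> (\<forall>x \<in> A. \<forall>y \<in> A. x \<preceq> y \<longleftrightarrow> f x \<preceq> f y))"

end

theory Submission
  imports Defs
begin

text \<open>
  Suppose that exactly one segment of \<open>a\<close> ends in \<open>k\<close> and none ends in \<open>k - 1\<close>. Then the
  no-linked-pair condition in \<open>S(a)\<^sub>k\<close> is vacuous, and the condition on degrees says that \<open>k\<close>
  is still an end of \<open>c\<close> (lemma \<open>S_trunc1_eq\<close>). On such \<open>c\<close>, truncation at \<open>k\<close> is injective, its
  inverse being \<open>extend k\<close>: prolong the segment ending in \<open>k - 1\<close> to \<open>k\<close>, or add the segment
  \<open>[k,k]\<close> if there is none. Truncation and extension both carry elementary operations to elementary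
  operations (lemmas \<open>trunc_elementary_op\<close> and \<open>extend_elementary_op\<close>), so \<open>S(a)\<^sub>k\<close> is isomorphic
  to the set \<open>S\<close> of the truncation of \<open>a\<close>. As elementary operations never create new ends,
  \<open>S(a)\<^sub>k\<close> is upward closed in \<open>S(a)\<close>. Both facts persist under successive truncations that
  satisfy the hypothesis at each step (lemma \<open>truncs_iso\<close>).

  An ordinary multisegment is such a successive truncation of a symmetric one: as long as some end
  is smaller than the largest beginning, there is an end \<open>e\<close> for which \<open>e + 1\<close> is free, and
  \<open>extend (e + 1)\<close> moves it up by one. With suitably bounded \<open>e\<close> this stops at a symmetric
  multisegment (lemma \<open>symmetric_extension\<close>), which gives the first part.

  For the second part, \<open>S(a)\<close> has a smallest element: reduction by elementary operations terminates,
  and a multisegment without linked pairs is determined by its content (lemma \<open>unlinked_unique\<close>),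
  which elementary operations preserve. The preimage of the smallest element is the smallest
  element \<open>a'\<close> of an upward closed set, and hence that set consists of all elements above \<open>a'\<close>.
\<close>

section \<open>Elementary operations in coordinates\<close>

text \<open>
  The multisegment \<open>r\<close> together with \<open>[i,j]\<close>, where an empty segment (\<open>i > j\<close>) is discarded.
  In this notation an elementary operation just exchanges two ends \<open>j\<close> and \<open>j'\<close>, including the
  case in which the two segments are adjacent and their intersection is empty.
\<close>

definition add_seg :: "int \<Rightarrow> int \<Rightarrow> multisegment \<Rightarrow> multisegment" where
  "add_seg i j r = (if i \<le> j then add_mset {i..j} r else r)"

text \<open>The multisets of all ends and of all beginnings of segments.\<close>

definition ends :: "multisegment \<Rightarrow> int multiset" where
  "ends a = image_mset seg_end a"

definition begins :: "multisegment \<Rightarrow> int multiset" where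
  "begins a = image_mset seg_begin a"

lemma seg_end_interval [simp]: "i \<le> j \<Longrightarrow> seg_end {i..j} = j"
  unfolding seg_end_def by (rule Max_eqI) auto

lemma seg_begin_interval [simp]: "i \<le> j \<Longrightarrow> seg_begin {i..j} = i"
  unfolding seg_begin_def by (rule Min_eqI) auto

lemma is_segment_interval [simp]: "is_segment {i..j} \<longleftrightarrow> i \<le> j"
proof
  assume "is_segment {i..j}"
  then have "{i..j} \<noteq> {}" unfolding is_segment_def by force
  then show "i \<le> j" by simp
qed (auto simp: is_segment_def)

lemma multisegmentE:
  assumes "is_multisegment a" "D \<in># a"
  obtains i j where "i \<le> j" "D = {i..j}"
  using assms unfolding is_multisegment_def is_segment_def by blast

lemma ends_add_seg: "ends (add_seg i j r) = (if i \<le> j then add_mset j (ends r) else ends r)"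
  by (simp add: ends_def add_seg_def)

lemma begins_add_seg: "begins (add_seg i j r) = (if i \<le> j then add_mset i (begins r) else begins r)"
  by (simp add: begins_def add_seg_def)

lemma is_multisegment_add_seg [simp]:
  "is_multisegment (add_seg i j r) \<longleftrightarrow> is_multisegment r"
  by (simp add: is_multisegment_def add_seg_def)

lemma obtain_seg_with_end:
  assumes "is_multisegment a" "k \<in># ends a"
  obtains i r where "i \<le> k" "a = add_seg i k r" "is_multisegment r"
proof -
  obtain D where D: "D \<in># a" "seg_end D = k" using assms(2) by (auto simp: ends_def)
  then obtain i j where ij: "i \<le> j" "D = {i..j}"
    using assms(1) by (auto simp: is_multisegment_def is_segment_def)
  obtain r where r: "a = add_mset D r" using D by (meson mset_add)
  have "a = add_seg i k r" "i \<le> k" using ij r D by (auto simp: add_seg_def)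
  with assms(1) that show ?thesis by auto
qed

lemma linked_interval_iff:
  assumes "p \<le> q" "s \<le> t"
  shows "linked {p..q} {s..t} \<longleftrightarrow> p < s \<and> s \<le> q + 1 \<and> q < t \<or> s < p \<and> p \<le> t + 1 \<and> t < q"
proof
  assume L: "linked {p..q} {s..t}"
  then obtain u v where uv: "{p..q} \<union> {s..t} = {u..v}"
    unfolding linked_def is_segment_def by blast
  have *: "p \<in> {u..v}" "q \<in> {u..v}" "s \<in> {u..v}" "t \<in> {u..v}"
    using assms unfolding uv[symmetric] by auto
  have "q + 1 \<in> {p..q} \<union> {s..t}" if "q + 1 < s" unfolding uv using * that by auto
  moreover have "t + 1 \<in> {p..q} \<union> {s..t}" if "t + 1 < p" unfolding uv using * that by auto
  moreover have "\<not> (s \<le> p \<and> q \<le> t)" "\<not> (p \<le> s \<and> t \<le> q)"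
    using L assms unfolding linked_def by auto
  ultimately show "p < s \<and> s \<le> q + 1 \<and> q < t \<or> s < p \<and> p \<le> t + 1 \<and> t < q"
    using assms by fastforce
next
  assume R: "p < s \<and> s \<le> q + 1 \<and> q < t \<or> s < p \<and> p \<le> t + 1 \<and> t < q"
  then have "{p..q} \<union> {s..t} = {min p s..max q t}" using assms by auto
  with R assms show "linked {p..q} {s..t}"
    unfolding linked_def by auto
qed

lemma Un_Int_interval:
  fixes i j :: int
  assumes "i < i'" "i' \<le> j + 1" "j < j'"
  shows "{i..j} \<union> {i'..j'} = {i..j'}" "{i..j} \<inter> {i'..j'} = {i'..j}"
  using assms by auto

lemma elementary_opI:
  assumes "i < i'" "i' \<le> j + 1" "j < j'"
  shows "elementary_op (add_seg i j (add_seg i' j' r)) (add_seg i j' (add_seg i' j r))"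
proof -
  have L: "linked {i..j} {i'..j'}" using assms by (subst linked_interval_iff) auto
  note U = Un_Int_interval[OF assms]
  show ?thesis
    unfolding elementary_op_def
    by (rule exI[of _ "{i..j}"], rule exI[of _ "{i'..j'}"], unfold U)
       (use assms L in \<open>auto simp: add_seg_def discard_empty_def\<close>)
qed

lemma elementary_opE:
  assumes "elementary_op a b" "is_multisegment a"
  obtains i i' j j' r where "i < i'" "i' \<le> j + 1" "j < j'" "is_multisegment r"
    "a = add_seg i j (add_seg i' j' r)" "b = add_seg i j' (add_seg i' j r)"
proof -
  obtain D E where DE: "{#D, E#} \<subseteq># a" "linked D E"
    "b = a - {#D, E#} + discard_empty {#D \<union> E, D \<inter> E#}"
    using assms(1) unfolding elementary_op_def by blast
  define r where "r = a - {#D, E#}"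
  have a: "a = {#D, E#} + r" using DE(1) by (metis r_def subset_mset.add_diff_inverse)
  have b: "b = r + discard_empty {#D \<union> E, D \<inter> E#}" using DE(3) by (simp add: r_def)
  obtain p q s t where pq: "p \<le> q" "s \<le> t" "D = {p..q}" "E = {s..t}"
    using assms(2) unfolding a is_multisegment_def is_segment_def by auto
  have r: "is_multisegment r" using assms(2) unfolding a is_multisegment_def by simp
  consider "p < s" "s \<le> q + 1" "q < t" | "s < p" "p \<le> t + 1" "t < q"
    using DE(2) pq linked_interval_iff by blast
  then show ?thesis
  proof cases
    case 1
    note U = Un_Int_interval[OF this]
    show ?thesis
      by (rule that[of p s q t r])
        (use 1 r pq in \<open>simp_all add: a b U add_seg_def discard_empty_def\<close>)
  next
    case 2
    note U = Un_Int_interval[OF this]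
    show ?thesis
      by (rule that[of s p t q r])
        (use 2 r pq in \<open>simp_all add: a b U add_seg_def discard_empty_def
            Un_commute[of "{p..q}"] Int_commute[of "{p..q}"]\<close>)
  qed
qed

lemma is_multisegment_elementary_op:
  "elementary_op a b \<Longrightarrow> is_multisegment a \<Longrightarrow> is_multisegment b"
  by (elim elementary_opE) auto

lemma ends_elementary_op:
  assumes "elementary_op a b" "is_multisegment a"
  shows "ends b \<subseteq># ends a"
  using assms by (elim elementary_opE) (auto simp: ends_add_seg subseteq_mset_def)

lemma mseg_le_refl: "a \<preceq> a"
  by (simp add: mseg_le_def)

lemma mseg_le_trans: "a \<preceq> b \<Longrightarrow> b \<preceq> c \<Longrightarrow> a \<preceq> c"
  unfolding mseg_le_def by auto

lemma mseg_le_step: "elementary_op a b \<Longrightarrow> b \<preceq> a"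
  unfolding mseg_le_def by auto

lemma mseg_le_induct [consumes 2, case_names refl step]:
  assumes "b \<preceq> a" "is_multisegment a"
    and "P a"
    and "\<And>x y. x \<preceq> a \<Longrightarrow> is_multisegment x \<Longrightarrow> elementary_op x y \<Longrightarrow> P x \<Longrightarrow> P y"
  shows "P b"
proof -
  have "elementary_op\<^sup>*\<^sup>* a b" using assms(1) by (simp add: mseg_le_def)
  then have "is_multisegment b \<and> P b"
  proof (induction rule: rtranclp_induct)
    case base
    then show ?case using assms by simp
  next
    case (step y z)
    then show ?case using assms(4)[of y z] is_multisegment_elementary_op
      by (auto simp: mseg_le_def)
  qed
  then show ?thesis by simp
qed

lemma is_multisegment_mseg_le: "b \<preceq> a \<Longrightarrow> is_multisegment a \<Longrightarrow> is_multisegment b"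
  by (erule mseg_le_induct) (auto intro: is_multisegment_elementary_op)

lemma ends_mseg_le: "b \<preceq> a \<Longrightarrow> is_multisegment a \<Longrightarrow> ends b \<subseteq># ends a"
  by (induction rule: mseg_le_induct) (auto dest: ends_elementary_op)

section \<open>Content and the smallest element\<close>

text \<open>The multiset of all points of segments, each counted once for every segment containing it.\<close>

definition content :: "multisegment \<Rightarrow> int multiset" where
  "content a = (\<Sum>D\<in>#a. mset_set D)"

lemma content_add_seg: "content (add_seg i j r) = mset_set {i..j} + content r"
  by (simp add: content_def add_seg_def)

lemma size_content: "is_multisegment a \<Longrightarrow> size (content a) = mdeg a"
  by (induction a) (auto simp: content_def mdeg_def is_multisegment_def is_segment_def)

lemma content_mseg_le:
  assumes "b \<preceq> a" "is_multisegment a"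
  shows "content b = content a"
  using assms
proof (induction rule: mseg_le_induct)
  case (step x y)
  from step(3,2) show ?case
  proof (cases rule: elementary_opE)
    case (1 i i' j j' r)
    then have "mset_set {i..j} + mset_set {i'..j'} = mset_set {i..j'} + mset_set {i'..j}"
      by (intro multiset_eqI) (auto simp: count_mset_set')
    with 1 have "content y = content x"
      by (simp add: content_add_seg flip: add.assoc)
    with step.IH show ?thesis by simp
  qed
qed simp

lemma mdeg_mseg_le: "b \<preceq> a \<Longrightarrow> is_multisegment a \<Longrightarrow> mdeg b = mdeg a"
  by (metis content_mseg_le is_multisegment_mseg_le size_content)

text \<open>No two segments are linked. A segment is never linked to itself, so the two quantified
  segments need not be assumed distinct.\<close>

definition unlinked :: "multisegment \<Rightarrow> bool" where
  "unlinked a \<longleftrightarrow> (\<forall>D\<in>#a. \<forall>E\<in>#a. \<not> linked D E)"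

lemma in_content_iff:
  assumes "is_multisegment a"
  shows "x \<in># content a \<longleftrightarrow> (\<exists>D\<in>#a. x \<in> D)"
  using assms
  by (induction a) (auto simp: content_def is_multisegment_def is_segment_def)

text \<open>
  If \<open>x\<close> is the first point of an unlinked multisegment, then a longest segment starting at \<open>x\<close>
  extends to the first gap of the content: a segment through the next point would be linked to it.
  So the content alone determines one segment, which is what allows the induction in
  \<open>unlinked_unique\<close>.
\<close>

lemma unlinked_first_component:
  assumes a: "is_multisegment a" "unlinked a" "a \<noteq> {#}"
    and x: "x = Min (set_mset (content a))"
  shows "\<exists>j\<ge>x. {x..j} \<in># a \<and> {x..j} \<subseteq> set_mset (content a) \<and> j + 1 \<notin># content a"
proof -
  have seg: "\<exists>i j. i \<le> j \<and> D = {i..j}" if "D \<in># a" for D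
    using a that by (auto simp: is_multisegment_def is_segment_def)
  note ic = in_content_iff[OF a(1)]
  obtain D0 where "D0 \<in># a" using a(3) by blast
  then have "content a \<noteq> {#}" using seg ic by fastforce
  then have xin: "x \<in># content a" and xmin: "\<And>y. y \<in># content a \<Longrightarrow> x \<le> y"
    using x by auto
  define J where "J = {j. x \<le> j \<and> {x..j} \<in># a}"
  have "J \<subseteq> seg_end ` set_mset a" unfolding J_def by force
  then have fin: "finite J" using finite_surj by blast
  obtain D i0 j0 where D: "D \<in># a" "x \<in> D" "i0 \<le> j0" "D = {i0..j0}"
    using xin ic seg by blast
  have "i0 = x" using D xmin[of i0] ic by force
  then have "j0 \<in> J" using D by (auto simp: J_def)
  then have "J \<noteq> {}" by blast
  define j where "j = Max J"
  have j: "j \<in> J" "\<And>l. l \<in> J \<Longrightarrow> l \<le> j" using fin \<open>J \<noteq> {}\<close> by (auto simp: j_def)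
  have "j + 1 \<notin># content a"
  proof
    assume "j + 1 \<in># content a"
    then obtain E i' j' where E: "E \<in># a" "j + 1 \<in> E" "i' \<le> j'" "E = {i'..j'}"
      using ic seg by blast
    have "x \<le> i'" using E xmin[of i'] ic by force
    moreover have "i' \<noteq> x" using E j(2)[of j'] by (auto simp: J_def)
    ultimately have "linked {x..j} E"
      using E j(1) by (auto simp: linked_interval_iff J_def)
    with a(2) E j(1) show False by (auto simp: unlinked_def J_def)
  qed
  with j(1) ic show ?thesis by (auto simp: J_def)
qed

lemma unlinked_unique:
  assumes "is_multisegment a" "is_multisegment b" "unlinked a" "unlinked b" "content a = content b"
  shows "a = b"
  using assms
proof (induction "size a" arbitrary: a b)
  case 0
  then have "content b = {#}" by (simp add: content_def)
  have False if D: "D \<in># b" for D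
  proof -
    obtain i j where "i \<le> j" "D = {i..j}" using multisegmentE[OF 0(3) D] .
    then have "i \<in># content b" using in_content_iff[OF 0(3)] D by auto
    with \<open>content b = {#}\<close> show False by simp
  qed
  then have "b = {#}" by blast
  with 0 show ?case by simp
next
  case (Suc n)
  then have ane: "a \<noteq> {#}" by auto
  then obtain D where D: "D \<in># a" by blast
  then have "D \<noteq> {}" using Suc(3) by (auto simp: is_multisegment_def is_segment_def)
  then have "content a \<noteq> {#}" using in_content_iff[OF Suc(3)] D by force
  then have bne: "b \<noteq> {#}" using Suc(7) by (auto simp: content_def)
  define x where "x = Min (set_mset (content a))"
  obtain j where j: "x \<le> j" "{x..j} \<in># a" "{x..j} \<subseteq> set_mset (content a)" "j + 1 \<notin># content a"
    using unlinked_first_component[OF Suc(3,5) ane x_def] by blast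
  obtain l where l: "x \<le> l" "{x..l} \<in># b" "{x..l} \<subseteq> set_mset (content a)" "l + 1 \<notin># content a"
    using unlinked_first_component[OF Suc(4,6) bne] x_def Suc(7) by auto
  \<comment> \<open>Both \<open>j + 1\<close> and \<open>l + 1\<close> are missing from the common content.\<close>
  have "\<not> j < l" "\<not> l < j" using j l by (auto simp: subset_iff)
  then have "l = j" by simp
  obtain r where r: "a = add_mset {x..j} r" using j(2) by (meson mset_add)
  obtain s where s: "b = add_mset {x..j} s" using l(2) \<open>l = j\<close> by (metis mset_add)
  have "r = s"
    by (rule Suc(1)) (use Suc(2-7) r s in \<open>auto simp: is_multisegment_def unlinked_def content_def\<close>)
  with r s show ?case by simp
qed

text \<open>
  The sum of the squares of the lengths. It is bounded in terms of the degree and grows strictly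
  under elementary operations, which therefore terminate.
\<close>

definition energy :: "multisegment \<Rightarrow> int" where
  "energy a = (\<Sum>D\<in>#a. (int (card D))\<^sup>2)"

lemma energy_add_seg: "i \<le> j + 1 \<Longrightarrow> energy (add_seg i j r) = (j - i + 1)\<^sup>2 + energy r"
proof (cases "i \<le> j")
  case False
  assume "i \<le> j + 1"
  with False have "i = j + 1" by simp
  then show ?thesis by (simp add: add_seg_def)
qed (simp add: energy_def add_seg_def)

lemma energy_le: "energy a \<le> (int (mdeg a))\<^sup>2"
proof (induction a)
  case (add D a)
  have "0 \<le> int (card D) * int (mdeg a)" by simp
  then show ?case using add by (simp add: energy_def mdeg_def power2_sum)
qed (simp add: energy_def mdeg_def)

lemma energy_elementary_op:
  assumes "elementary_op a b" "is_multisegment a"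
  shows "energy a < energy b"
  using assms
proof (cases rule: elementary_opE)
  case (1 i i' j j' r)
  \<comment> \<open>The lengths add up to the same sum, but lie further apart after the operation.\<close>
  have "0 < 2 * ((j' - j) * (i' - i))" using 1 by simp
  also have "\<dots> = energy b - energy a"
    using 1 by (simp add: energy_add_seg power2_eq_square algebra_simps)
  finally show ?thesis by simp
qed

lemma exists_unlinked_below:
  assumes "is_multisegment a"
  shows "\<exists>m. m \<preceq> a \<and> unlinked m"
  using assms
proof (induction "nat ((int (mdeg a))\<^sup>2 - energy a)" arbitrary: a rule: less_induct)
  case less
  show ?case
  proof (cases "unlinked a")
    case True
    then show ?thesis using mseg_le_refl by blast
  next
    case False
    then obtain D E where DE: "D \<in># a" "E \<in># a" "linked D E" by (auto simp: unlinked_def)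
    then have "D \<noteq> E" by (auto simp: linked_def)
    obtain r where r: "a = add_mset D r" using DE(1) by (meson mset_add)
    then have "{#D, E#} \<subseteq># a" using DE(2) \<open>D \<noteq> E\<close> by simp
    then obtain b where b: "elementary_op a b" using DE(3) unfolding elementary_op_def by blast
    have "energy a < energy b" using energy_elementary_op b less.prems by simp
    moreover have "mdeg b = mdeg a" using mdeg_mseg_le mseg_le_step b less.prems by blast
    moreover have "energy b \<le> (int (mdeg b))\<^sup>2" by (rule energy_le)
    ultimately have "nat ((int (mdeg b))\<^sup>2 - energy b) < nat ((int (mdeg a))\<^sup>2 - energy a)" by simp
    with less.hyps obtain m where "m \<preceq> b" "unlinked m"
      using b is_multisegment_elementary_op less.prems by blast
    then show ?thesis using mseg_le_trans mseg_le_step b by blast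
  qed
qed

lemma exists_minimum:
  assumes "is_multisegment a"
  shows "\<exists>m\<in>S a. \<forall>b\<in>S a. m \<preceq> b"
proof -
  obtain m where m: "m \<preceq> a" "unlinked m" using exists_unlinked_below[OF assms] by blast
  have "m \<preceq> b" if "b \<preceq> a" for b
  proof -
    have b: "is_multisegment b" using that assms is_multisegment_mseg_le by blast
    obtain n where n: "n \<preceq> b" "unlinked n" using exists_unlinked_below[OF b] by blast
    then have "n \<preceq> a" using that mseg_le_trans by blast
    then have "m = n"
      using m n assms by (intro unlinked_unique) (auto simp: is_multisegment_mseg_le content_mseg_le)
    with n show ?thesis by simp
  qed
  with m(1) show ?thesis by (auto simp: S_def)
qed

section \<open>One truncation\<close>

lemma trunc_add_seg: "trunc k (add_seg i j r) = add_seg i (if j = k then j - 1 else j) (trunc k r)"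
proof (cases "i \<le> j")
  case True
  then show ?thesis by (simp add: trunc_def add_seg_def trunc_seg_def discard_empty_def)
qed (simp add: add_seg_def)

lemma trunc_id:
  assumes "is_multisegment r" "k \<notin># ends r"
  shows "trunc k r = r"
  using assms
  by (induction r) (auto simp: trunc_def discard_empty_def ends_def trunc_seg_def
      is_multisegment_def is_segment_def)

lemma mdeg_trunc:
  assumes "is_multisegment a"
  shows "mdeg (trunc k a) + count (ends a) k = mdeg a"
  using assms
proof (induction a)
  case (add D a)
  then obtain i j where D: "i \<le> j" "D = {i..j}" by (auto simp: is_multisegment_def is_segment_def)
  have "is_multisegment a" using add by (simp add: is_multisegment_def)
  with add.IH D show ?case
    by (auto simp: trunc_def discard_empty_def trunc_seg_def mdeg_def ends_def)
qed (simp_all add: trunc_def mdeg_def ends_def discard_empty_def)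

text \<open>
  The inverse of truncation at \<open>k\<close>. If no segment ends in \<open>k - 1\<close>, then truncation has discarded
  an empty segment, which can only come from \<open>[k,k]\<close>.
\<close>

definition extend :: "int \<Rightarrow> multisegment \<Rightarrow> multisegment" where
  "extend k b = (if k - 1 \<in># ends b
     then image_mset (\<lambda>D. if seg_end D = k - 1 then {seg_begin D..k} else D) b
     else add_mset {k} b)"

lemma extend_no_end: "k - 1 \<notin># ends r \<Longrightarrow> extend k r = add_seg k k r"
  by (simp add: extend_def add_seg_def)

lemma extend_end:
  assumes "i \<le> k - 1" "k - 1 \<notin># ends r"
  shows "extend k (add_seg i (k - 1) r) = add_seg i k r"
proof -
  have "image_mset (\<lambda>D. if seg_end D = k - 1 then {seg_begin D..k} else D) r = r"
    using assms(2) by (induction r) (auto simp: ends_def)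
  with assms show ?thesis by (simp add: extend_def add_seg_def ends_def)
qed

lemma extend_add_seg_other: "j \<noteq> k - 1 \<Longrightarrow> extend k (add_seg i j r) = add_seg i j (extend k r)"
  by (auto simp: extend_def add_seg_def ends_def)

text \<open>The multisegments on which truncation at \<open>k\<close> lowers the end of a single segment to an
  integer that is not yet an end, and, in \<open>extendable\<close>, the results of such truncations.\<close>

definition truncatable :: "int \<Rightarrow> multisegment \<Rightarrow> bool" where
  "truncatable k a \<longleftrightarrow> is_multisegment a \<and> count (ends a) k = 1 \<and> k - 1 \<notin># ends a"

definition extendable :: "int \<Rightarrow> multisegment \<Rightarrow> bool" where
  "extendable k b \<longleftrightarrow> is_multisegment b \<and> k \<notin># ends b \<and> count (ends b) (k - 1) \<le> 1"

lemma truncatableE: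
  assumes "truncatable k a"
  obtains i r where "i \<le> k" "a = add_seg i k r" "is_multisegment r" "k \<notin># ends r" "k - 1 \<notin># ends r"
proof -
  have "k \<in># ends a" using assms by (simp add: truncatable_def flip: count_greater_zero_iff)
  then obtain i r where "i \<le> k" "a = add_seg i k r" "is_multisegment r"
    using assms obtain_seg_with_end unfolding truncatable_def by blast
  then show ?thesis using that assms
    by (auto simp: truncatable_def ends_add_seg count_eq_zero_iff)
qed

lemma trunc_extendable: 
  assumes "truncatable k a"
  shows "extendable k (trunc k a)" "extend k (trunc k a) = a"
proof -
  obtain i r where r: "i \<le> k" "a = add_seg i k r" "is_multisegment r" "k \<notin># ends r" "k - 1 \<notin># ends r"
    using assms by (elim truncatableE)
  have t: "trunc k a = add_seg i (k - 1) r" using r by (simp add: trunc_add_seg trunc_id)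
  show "extendable k (trunc k a)"
    unfolding t using r(3-) by (simp add: extendable_def ends_add_seg not_in_iff)
  show "extend k (trunc k a) = a"
  proof (cases "i \<le> k - 1")
    case True
    then show ?thesis unfolding t using r by (simp add: extend_end)
  next
    case False
    then have "i = k" using r by simp
    then show ?thesis unfolding t using r by (simp add: extend_no_end add_seg_def[of k "k - 1"])
  qed
qed

lemma extend_truncatable:
  assumes "extendable k b"
  shows "truncatable k (extend k b)" "trunc k (extend k b) = b"
proof -
  have "\<exists>i r. i \<le> k \<and> b = add_seg i (k - 1) r \<and> extend k b = add_seg i k r
      \<and> is_multisegment r \<and> k \<notin># ends r \<and> k - 1 \<notin># ends r"
  proof (cases "k - 1 \<in># ends b")
    case True
    then obtain i r where r: "i \<le> k - 1" "b = add_seg i (k - 1) r" "is_multisegment r"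
      using assms obtain_seg_with_end unfolding extendable_def by blast
    then have "k \<notin># ends r" "k - 1 \<notin># ends r"
      using assms by (auto simp: extendable_def ends_add_seg count_eq_zero_iff)
    with r show ?thesis by (intro exI[of _ i] exI[of _ r]) (simp add: extend_end)
  next
    case False
    then show ?thesis using assms
      by (intro exI[of _ k] exI[of _ b])
        (simp add: extend_no_end extendable_def add_seg_def[of k "k - 1"])
  qed
  then obtain i r where r: "i \<le> k" "b = add_seg i (k - 1) r" "extend k b = add_seg i k r"
      "is_multisegment r" "k \<notin># ends r" "k - 1 \<notin># ends r" by blast
  show "truncatable k (extend k b)"
    using r by (simp add: truncatable_def ends_add_seg not_in_iff)
  show "trunc k (extend k b) = b"
    using r by (simp add: trunc_add_seg trunc_id)
qed

text \<open>
  The hypothesis that \<open>k\<close> remains an end of \<open>y\<close> is needed: the operation taking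
  \<open>[i,k]\<close>, \<open>[k+1,j']\<close> to \<open>[i,j']\<close> has no counterpart after truncation, where a gap at \<open>k\<close>
  separates the two segments.
\<close>

lemma trunc_elementary_op:
  assumes xy: "elementary_op x y" and x: "truncatable k x" and y: "k \<in># ends y"
  shows "elementary_op (trunc k x) (trunc k y)"
proof -
  have "is_multisegment x" using x by (simp add: truncatable_def)
  with xy show ?thesis
  proof (cases rule: elementary_opE)
    case (1 i i' j j' r)
    then have ne: "j \<noteq> k - 1" "j' \<noteq> k - 1" using x by (auto simp: truncatable_def ends_add_seg)
    consider "j = k" | "j' = k" | "j \<noteq> k" "j' \<noteq> k" by blast
    then show ?thesis
    proof cases
      assume j: "j = k"
      then have "k \<notin># ends r" using 1 x by (simp add: truncatable_def ends_add_seg not_in_iff)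
      \<comment> \<open>If the two segments were merely adjacent, the end \<open>k\<close> would be lost in \<open>y\<close>.\<close>
      then have "i' \<le> k" using 1 y j by (auto simp: ends_add_seg split: if_splits)
      then show ?thesis using 1 j elementary_opI[of i i' "k - 1" j' "trunc k r"]
        ne by (simp add: trunc_add_seg)
    next
      assume j: "j' = k"
      then show ?thesis using 1 ne elementary_opI[of i i' j "k - 1" "trunc k r"]
        by (simp add: trunc_add_seg)
    next
      assume "j \<noteq> k" "j' \<noteq> k"
      then show ?thesis using 1 elementary_opI[of i i' j j' "trunc k r"]
        by (simp add: trunc_add_seg)
    qed
  qed
qed

lemma extend_elementary_op:
  assumes xy: "elementary_op x y" and x: "extendable k x"
  shows "elementary_op (extend k x) (extend k y)"
proof -
  have "is_multisegment x" using x by (simp add: extendable_def)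
  with xy show ?thesis
  proof (cases rule: elementary_opE)
    case (1 i i' j j' r)
    then have ne: "j \<noteq> k" "j' \<noteq> k" using x by (auto simp: extendable_def ends_add_seg)
    consider "j = k - 1" | "j' = k - 1" | "j \<noteq> k - 1" "j' \<noteq> k - 1" by blast
    then show ?thesis
    proof cases
      assume j: "j = k - 1"
      then have r: "k - 1 \<notin># ends r"
        using 1 x by (simp add: extendable_def ends_add_seg count_eq_zero_iff)
      have j': "k < j'" "i \<le> k - 1" using 1 j ne by auto
      have X: "extend k x = add_seg i k (add_seg i' j' r)"
        using 1 j j' r by (simp add: extend_end ends_add_seg)
      \<comment> \<open>For adjacent segments \<open>i' = k\<close>: their empty intersection extends to \<open>[k,k]\<close>.\<close>
      have "extend k (add_seg i' (k - 1) r) = add_seg i' k r"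
      proof (cases "i' \<le> k - 1")
        case False
        then have "i' = k" using 1 j by simp
        then show ?thesis using r by (simp add: add_seg_def[of k "k - 1"] extend_no_end)
      qed (simp add: extend_end r)
      then have "extend k y = add_seg i j' (add_seg i' k r)"
        using 1 j j' by (simp add: extend_add_seg_other)
      with X show ?thesis using 1 j j' by (simp add: elementary_opI)
    next
      assume j: "j' = k - 1"
      then have r: "k - 1 \<notin># ends r" "j \<noteq> k - 1" "i' \<le> k - 1" "i \<le> k - 1"
        using 1 x by (auto simp: extendable_def ends_add_seg count_eq_zero_iff)
      have "extend k x = add_seg i j (add_seg i' k r)"
        using 1 j r by (simp add: extend_add_seg_other extend_end)
      moreover have "extend k y = add_seg i k (add_seg i' j r)"
        using 1 j r by (simp add: extend_end ends_add_seg)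
      ultimately show ?thesis using 1 j by (simp add: elementary_opI)
    next
      assume "j \<noteq> k - 1" "j' \<noteq> k - 1"
      then show ?thesis using 1 by (simp add: extend_add_seg_other elementary_opI)
    qed
  qed
qed

lemma truncatable_mseg_le:
  assumes "b \<preceq> a" "truncatable k a" "k \<in># ends b"
  shows "truncatable k b"
proof -
  have a: "is_multisegment a" using assms(2) by (simp add: truncatable_def)
  have sub: "ends b \<subseteq># ends a" using ends_mseg_le[OF assms(1) a] .
  then have "count (ends b) k \<le> 1" "k - 1 \<notin># ends b"
    using assms(2) by (auto simp: truncatable_def dest: mset_subset_eq_count[of _ _ k] mset_subset_eqD)
  moreover have "count (ends b) k > 0" using assms(3) by (simp only: count_greater_zero_iff)
  ultimately show ?thesis using is_multisegment_mseg_le[OF assms(1) a]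
    by (auto simp: truncatable_def simp del: count_greater_zero_iff)
qed

lemma extendable_mseg_le:
  assumes "b \<preceq> a" "extendable k a"
  shows "extendable k b"
proof -
  have a: "is_multisegment a" using assms(2) by (simp add: extendable_def)
  have sub: "ends b \<subseteq># ends a" using ends_mseg_le[OF assms(1) a] .
  then show ?thesis using is_multisegment_mseg_le[OF assms(1) a] assms(2)
      mset_subset_eq_count[OF sub, of "k - 1"]
    by (auto simp: extendable_def dest: mset_subset_eqD)
qed

lemma trunc_mono:
  assumes "b \<preceq> a" "truncatable k a" "k \<in># ends b"
  shows "trunc k b \<preceq> trunc k a"
proof -
  have "is_multisegment a" using assms(2) by (simp add: truncatable_def)
  from assms(1) this have "k \<in># ends b \<longrightarrow> trunc k b \<preceq> trunc k a"
  proof (induction rule: mseg_le_induct)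
    case (step x y)
    show ?case
    proof
      assume y: "k \<in># ends y"
      then have x: "k \<in># ends x" using ends_elementary_op step by (meson mset_subset_eqD)
      then have "truncatable k x" using truncatable_mseg_le step assms by blast
      then have "elementary_op (trunc k x) (trunc k y)" using trunc_elementary_op step y by blast
      with step x show "trunc k y \<preceq> trunc k a" using mseg_le_trans mseg_le_step by blast
    qed
  qed (simp add: mseg_le_refl)
  with assms show ?thesis by blast
qed

lemma extend_mono:
  assumes "b \<preceq> a" "extendable k a"
  shows "extend k b \<preceq> extend k a"
proof -
  have "is_multisegment a" using assms(2) by (simp add: extendable_def)
  from assms(1) this show ?thesis
  proof (induction rule: mseg_le_induct)
    case (step x y)
    then have "elementary_op (extend k x) (extend k y)"
      using extend_elementary_op extendable_mseg_le assms by blast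
    with step show ?case using mseg_le_trans mseg_le_step by blast
  qed (simp add: mseg_le_refl)
qed

lemma S_trunc1_eq:
  assumes "truncatable k a"
  shows "S_trunc1 a k = {c \<in> S a. k \<in># ends c}"
proof -
  have a: "is_multisegment a" "count (ends a) k = 1" using assms by (auto simp: truncatable_def)
  have "c \<in> S_trunc1 a k \<longleftrightarrow> k \<in># ends c" if c: "c \<preceq> a" for c
  proof -
    have "mdeg (trunc k c) + count (ends c) k = mdeg (trunc k a) + count (ends a) k"
      using mdeg_trunc a c is_multisegment_mseg_le mdeg_mseg_le by metis
    moreover have "count (ends c) k \<le> 1"
      using mset_subset_eq_count[OF ends_mseg_le[OF c a(1)], of k] a by simp
    ultimately have deg: "mdeg (trunc k c) = mdeg (trunc k a) \<longleftrightarrow> k \<in># ends c"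
      using a by (auto simp flip: count_greater_zero_iff)
    have "k - 1 \<notin># ends c"
      using ends_mseg_le[OF c a(1)] assms by (auto simp: truncatable_def dest: mset_subset_eqD)
    then have "seg_end D \<noteq> k - 1" if "D \<in># c" for D
      using that unfolding ends_def by (metis image_eqI set_image_mset)
    then have "\<not> (\<exists>D E. {#D, E#} \<subseteq># c \<and> linked D E \<and> seg_end D = k - 1 \<and> seg_end E = k)"
      by (meson mset_subset_eqD union_single_eq_member)
    with c deg show ?thesis by (auto simp: S_trunc1_def S_def)
  qed
  then show ?thesis by (auto simp: S_trunc1_def S_def)
qed

section \<open>Successive truncations\<close>

text \<open>Truncating successively at the members of a list, from left to right, meets the hypothesis
  \<open>truncatable\<close> at each step.\<close>

fun truncatable_list :: "int list \<Rightarrow> multisegment \<Rightarrow> bool" where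
  "truncatable_list [] a \<longleftrightarrow> is_multisegment a"
| "truncatable_list (k # ks) a \<longleftrightarrow> truncatable k a \<and> truncatable_list ks (trunc k a)"

lemma truncs_simps [simp]: "truncs [] a = a" "truncs (k # ks) a = truncs ks (trunc k a)"
  by (simp_all add: truncs_def)

lemma truncs_append: "truncs (ks @ ls) a = truncs ls (truncs ks a)"
  by (simp add: truncs_def)

lemma truncatable_list_append:
  "truncatable_list ks a \<Longrightarrow> truncatable_list ls (truncs ks a) \<Longrightarrow> truncatable_list (ks @ ls) a"
  by (induction ks arbitrary: a) auto

lemma S_trunc_Cons:
  assumes "truncatable k a"
  shows "S_trunc a (k # ks) = {c \<in> S a. k \<in># ends c \<and> trunc k c \<in> S_trunc (trunc k a) ks}"
  using trunc_mono[OF _ assms]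
  by (auto simp: S_trunc_def S_trunc1_eq[OF assms] S_def All_less_Suc2)

text \<open>
  Successive truncation is an isomorphism of partially ordered sets, and its domain is upward
  closed in \<open>S a\<close>.
\<close>

lemma truncs_iso:
  assumes "truncatable_list ks a"
  shows "bij_betw (truncs ks) (S_trunc a ks) (S (truncs ks a))" (is "?B")
    and "\<And>x y. x \<in> S_trunc a ks \<Longrightarrow> y \<in> S_trunc a ks \<Longrightarrow> x \<preceq> y \<longleftrightarrow> truncs ks x \<preceq> truncs ks y"
    and "\<And>x y. x \<in> S_trunc a ks \<Longrightarrow> y \<in> S a \<Longrightarrow> x \<preceq> y \<Longrightarrow> y \<in> S_trunc a ks"
proof -
  have "bij_betw (truncs ks) (S_trunc a ks) (S (truncs ks a))
      \<and> (\<forall>x\<in>S_trunc a ks. \<forall>y\<in>S_trunc a ks. x \<preceq> y \<longleftrightarrow> truncs ks x \<preceq> truncs ks y)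
      \<and> (\<forall>x\<in>S_trunc a ks. \<forall>y\<in>S a. x \<preceq> y \<longrightarrow> y \<in> S_trunc a ks)"
    using assms
  proof (induction ks arbitrary: a)
    case Nil
    then show ?case by (auto simp: S_trunc_def bij_betw_def inj_on_def)
  next
    case (Cons k ks)
    define A where "A = {c \<in> S a. k \<in># ends c}"
    define T where "T = S_trunc (trunc k a) ks"
    have a: "truncatable k a" and ks: "truncatable_list ks (trunc k a)" using Cons.prems by auto
    have ta: "extendable k (trunc k a)" "extend k (trunc k a) = a" using trunc_extendable[OF a] by auto
    have tA: "truncatable k c" if "c \<in> A" for c
      using that truncatable_mseg_le a by (auto simp: A_def S_def)
    note IH = Cons.IH[OF ks, folded T_def]
    have eq: "S_trunc a (k # ks) = {c \<in> A. trunc k c \<in> T}"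
      by (auto simp: S_trunc_Cons[OF a] A_def T_def)
    have lift: "extend k d \<in> A \<and> trunc k (extend k d) = d" if "d \<in> S (trunc k a)" for d
    proof -
      have d: "d \<preceq> trunc k a" using that by (simp add: S_def)
      then have e: "extendable k d" using extendable_mseg_le ta by blast
      have "extend k d \<preceq> a" using extend_mono[OF d ta(1)] ta(2) by simp
      moreover have "k \<in># ends (extend k d)"
        using extend_truncatable(1)[OF e] by (simp add: truncatable_def flip: count_greater_zero_iff)
      ultimately show ?thesis using extend_truncatable(2)[OF e] by (simp add: A_def S_def)
    qed
    have TS: "T \<subseteq> S (trunc k a)" by (auto simp: T_def S_trunc_def)
    have b1: "bij_betw (trunc k) {c \<in> A. trunc k c \<in> T} T"
      by (rule bij_betw_byWitness[where f' = "extend k"])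
        (use lift TS trunc_extendable(2)[OF tA] in auto)
    have iff1: "x \<preceq> y \<longleftrightarrow> trunc k x \<preceq> trunc k y" if "x \<in> A" "y \<in> A" for x y
    proof
      assume "x \<preceq> y"
      then show "trunc k x \<preceq> trunc k y" using trunc_mono tA that by (simp add: A_def)
    next
      assume "trunc k x \<preceq> trunc k y"
      then have "extend k (trunc k x) \<preceq> extend k (trunc k y)"
        using extend_mono trunc_extendable(1) tA that by blast
      then show "x \<preceq> y" using trunc_extendable(2) tA that by simp
    qed
    have up: "y \<in> S_trunc a (k # ks)" if x: "x \<in> S_trunc a (k # ks)" and y: "y \<in> S a" "x \<preceq> y" for x y
    proof -
      have "x \<in> A" "trunc k x \<in> T" using x eq by auto
      have "is_multisegment y"
        using y a is_multisegment_mseg_le by (auto simp: S_def truncatable_def)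
      then have "k \<in># ends y"
        using ends_mseg_le[OF y(2)] \<open>x \<in> A\<close> by (auto simp: A_def dest: mset_subset_eqD)
      then have "y \<in> A" using y by (simp add: A_def)
      then have "trunc k x \<preceq> trunc k y" using iff1 \<open>x \<in> A\<close> y by blast
      moreover have "trunc k y \<in> S (trunc k a)"
        using trunc_mono[OF _ a] \<open>y \<in> A\<close> by (auto simp: A_def S_def)
      ultimately have "trunc k y \<in> T" using IH \<open>trunc k x \<in> T\<close> by blast
      with \<open>y \<in> A\<close> eq show ?thesis by simp
    qed
    have "bij_betw (truncs ks \<circ> trunc k) (S_trunc a (k # ks)) (S (truncs (k # ks) a))"
      unfolding eq by (rule bij_betw_trans[OF b1]) (simp add: IH)
    moreover have "truncs ks \<circ> trunc k = truncs (k # ks)" by (simp add: fun_eq_iff)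
    moreover have "\<forall>x\<in>S_trunc a (k # ks). \<forall>y\<in>S_trunc a (k # ks).
        x \<preceq> y \<longleftrightarrow> truncs (k # ks) x \<preceq> truncs (k # ks) y"
      using IH iff1 eq by simp
    ultimately show ?case using up by (metis (no_types, lifting))
  qed
  then show ?B and "\<And>x y. x \<in> S_trunc a ks \<Longrightarrow> y \<in> S_trunc a ks \<Longrightarrow> x \<preceq> y \<longleftrightarrow> truncs ks x \<preceq> truncs ks y"
    and "\<And>x y. x \<in> S_trunc a ks \<Longrightarrow> y \<in> S a \<Longrightarrow> x \<preceq> y \<Longrightarrow> y \<in> S_trunc a ks"
    by blast+
qed

lemma order_iso_sym:
  assumes "order_iso A B"
  shows "order_iso B A"
proof -
  obtain f where f: "bij_betw f A B" "\<forall>x\<in>A. \<forall>y\<in>A. x \<preceq> y \<longleftrightarrow> f x \<preceq> f y"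
    using assms unfolding order_iso_def by blast
  have "inv_into A f x \<in> A \<and> f (inv_into A f x) = x" if "x \<in> B" for x
    using that f(1) by (metis bij_betw_def f_inv_into_f inv_into_into)
  with f(2) have "\<forall>x\<in>B. \<forall>y\<in>B. x \<preceq> y \<longleftrightarrow> inv_into A f x \<preceq> inv_into A f y" by metis
  with bij_betw_inv_into[OF f(1)] show ?thesis unfolding order_iso_def by blast
qed

section \<open>Extension to a symmetric multisegment\<close>

lemma pairs_distinct_iff:
  "(\<forall>D E. {#D, E#} \<subseteq># a \<longrightarrow> f D \<noteq> f E) \<longleftrightarrow> (\<forall>x. count (image_mset f a) x \<le> 1)"
proof (intro iffI allI impI)
  fix x assume *: "\<forall>D E. {#D, E#} \<subseteq># a \<longrightarrow> f D \<noteq> f E"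
  show "count (image_mset f a) x \<le> 1"
  proof (rule ccontr)
    assume c: "\<not> count (image_mset f a) x \<le> 1"
    then have "0 < count (image_mset f a) x" by linarith
    then obtain D where D: "D \<in># a" "f D = x" unfolding count_greater_zero_iff by auto
    obtain r where r: "a = add_mset D r" using D(1) by (meson mset_add)
    have "0 < count (image_mset f r) x" using c D r by auto
    then obtain E where E: "E \<in># r" "f E = x" unfolding count_greater_zero_iff by auto
    then have "{#D, E#} \<subseteq># a" using r by simp
    then have "f D \<noteq> f E" using * by blast
    with D E show False by simp
  qed
next
  fix D E assume *: "\<forall>x. count (image_mset f a) x \<le> 1" and "{#D, E#} \<subseteq># a"
  then have "image_mset f {#D, E#} \<subseteq># image_mset f a" by (intro image_mset_subseteq_mono)
  then have "{#f D, f E#} \<subseteq># image_mset f a" by simp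
  then have "count {#f D, f E#} (f D) \<le> count (image_mset f a) (f D)"
    by (rule mset_subset_eq_count)
  also have "\<dots> \<le> 1" using * by blast
  finally show "f D \<noteq> f E" by (auto split: if_splits)
qed

lemma ordinary_iff:
  "ordinary a \<longleftrightarrow> is_multisegment a \<and> (\<forall>x. count (begins a) x \<le> 1) \<and> (\<forall>x. count (ends a) x \<le> 1)"
  unfolding ordinary_def begins_def ends_def
  using pairs_distinct_iff[of a seg_begin] pairs_distinct_iff[of a seg_end] by blast

text \<open>
  By pigeonhole: otherwise all integers from \<open>e\<close> to \<open>L + size a\<close> would be ends, more than there
  are segments.
\<close>

lemma exists_free_end:
  assumes "e \<in># ends a" "e < L"
  shows "\<exists>e\<in>#ends a. e < L + int (size a) \<and> e + 1 \<notin># ends a"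
proof (rule ccontr)
  assume "\<not> ?thesis"
  then have next_end: "x + 1 \<in># ends a" if "x \<in># ends a" "x < L + int (size a)" for x
    using that by blast
  have "e + int n \<le> L + int (size a) \<longrightarrow> e + int n \<in># ends a" for n
  proof (induction n)
    case (Suc n)
    then show ?case using next_end[of "e + int n"] by (auto simp: algebra_simps)
  qed (use assms in simp)
  then have "(\<lambda>n. e + int n) ` {..size a} \<subseteq> set_mset (ends a)" using assms by auto
  then have "card ((\<lambda>n. e + int n) ` {..size a}) \<le> card (set_mset (ends a))"
    by (intro card_mono) auto
  moreover have "card ((\<lambda>n. e + int n) ` {..size a}) = size a + 1"
    by (subst card_image) (auto simp: inj_on_def)
  moreover have "card (set_mset (ends a)) \<le> size (ends a)"
    by (simp add: size_multiset_overloaded_eq) 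
      (metis card_eq_sum count_greater_eq_one_iff sum_mono)
  ultimately show False by (simp add: ends_def)
qed

text \<open>
  Only ends below the fixed bound \<open>L + size a\<close> are moved up, so the sum of the distances from the
  ends to this bound (counted as 0 beyond it) is a decreasing measure.
\<close>

lemma symmetric_extension:
  assumes "ordinary a" "\<forall>x\<in>#begins a. x \<le> L"
  shows "\<exists>s ks. symmetric s \<and> truncatable_list ks s \<and> truncs ks s = a"
  using assms
proof (induction "\<Sum>e\<in>#ends a. nat (L + int (size a) - e)" arbitrary: a rule: less_induct)
  case less
  have a: "is_multisegment a" "\<And>x. count (begins a) x \<le> 1" "\<And>x. count (ends a) x \<le> 1"
    using less.prems by (auto simp: ordinary_iff)
  show ?case
  proof (cases "\<forall>e\<in>#ends a. L \<le> e")
    case True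
    then have "symmetric a" using less.prems unfolding symmetric_def ends_def begins_def
      by fastforce
    then show ?thesis using a by (intro exI[of _ a] exI[of _ "[]"]) simp
  next
    case False
    then obtain e where e: "e \<in># ends a" "e < L + int (size a)" "e + 1 \<notin># ends a"
      using exists_free_end[of _ a L] by (meson not_le)
    obtain i r where r: "i \<le> e" "a = add_seg i e r" "is_multisegment r"
      using obtain_seg_with_end[OF a(1) e(1)] .
    have er: "e \<notin># ends r" "e + 1 \<notin># ends r"
      using a(3)[of e] e(3) r by (auto simp: ends_add_seg count_eq_zero_iff)
    define b where "b = extend (e + 1) a"
    have ea: "extendable (e + 1) a" using a e by (simp add: extendable_def)
    have b: "b = add_seg i (e + 1) r" using extend_end[of i "e + 1" r] r er by (simp add: b_def)
    have bb: "begins b = begins a" using r b by (simp add: begins_add_seg)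
    have "count (ends b) x \<le> 1" for x
      using a(3)[of x] er r b by (auto simp: ends_add_seg not_in_iff split: if_splits)
    then have "ordinary b" using a r b bb by (simp add: ordinary_iff)
    moreover have "(\<Sum>x\<in>#ends b. nat (L + int (size b) - x)) < (\<Sum>x\<in>#ends a. nat (L + int (size a) - x))"
      using r b e(2) by (simp add: ends_add_seg) (simp add: add_seg_def)
    ultimately obtain s ks where s: "symmetric s" "truncatable_list ks s" "truncs ks s = b"
      using less.hyps[of b] less.prems bb by auto
    have "truncatable (e + 1) b" "trunc (e + 1) b = a"
      using extend_truncatable[OF ea] by (auto simp: b_def)
    then have "truncatable_list (ks @ [e + 1]) s" "truncs (ks @ [e + 1]) s = a"
      using s a by (auto intro!: truncatable_list_append simp: truncs_append)
    with s(1) show ?thesis by blast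
  qed
qed

theorem proposition6p1p3:
  fixes a :: multisegment
  assumes "ordinary a"
  shows "\<exists>(asym :: multisegment) (ks :: int list).
           symmetric asym \<and>
           order_iso (S a) (S_trunc asym (rev ks)) \<and>
           (\<exists>a' \<in> S asym. S_trunc asym (rev ks) = {c \<in> S asym. a' \<preceq> c})"
proof -
  have ms: "is_multisegment a" using assms by (simp add: ordinary_def)
  have "\<forall>x\<in>#begins a. x \<le> Max (set_mset (begins a))" by simp
  then obtain s ls where s: "symmetric s" "truncatable_list ls s" "truncs ls s = a"
    using symmetric_extension[OF assms] by blast
  note bij = truncs_iso(1)[OF s(2), unfolded s(3)]
  note mono = truncs_iso(2)[OF s(2)]
  note up = truncs_iso(3)[OF s(2)]
  have "order_iso (S_trunc s ls) (S a)" 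
    unfolding order_iso_def by (intro exI[of _ "truncs ls"] conjI ballI bij mono)
  then have iso: "order_iso (S a) (S_trunc s ls)" by (rule order_iso_sym)
  obtain m where m: "m \<in> S a" "\<forall>b\<in>S a. m \<preceq> b" using exists_minimum[OF ms] by blast
  obtain a' where a': "a' \<in> S_trunc s ls" "truncs ls a' = m"
    using m(1) unfolding bij_betw_imp_surj_on[OF bij, symmetric] by (elim imageE) simp
  have sub: "S_trunc s ls \<subseteq> S s" unfolding S_trunc_def by blast
  have "a' \<preceq> c" if c: "c \<in> S_trunc s ls" for c
  proof -
    have "truncs ls c \<in> S a" using bij_betw_apply[OF bij c] .
    then show ?thesis using mono[OF a'(1) c] m(2) a'(2) by simp
  qed
  moreover have "c \<in> S_trunc s ls" if "c \<in> S s" "a' \<preceq> c" for c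
    using up[OF a'(1) that] .
  ultimately have "S_trunc s ls = {c \<in> S s. a' \<preceq> c}" using sub by blast
  with s(1) iso a'(1) sub show ?thesis
    by (intro exI[of _ s] exI[of _ "rev ls"]) auto
qed

end
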